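(* Let $X$ be a scalar (real-valued) random variable whose probability density is logarithmically concave, let $\eta\in[0,1]$ be a prescribed probability value, and let the distortion function be the absolute error $\delta(x)=|x|$. Then a centered silence set minimizes the mean absolute estimation error; that is, if $\mathscr{S}$ is a silence set with $\mathbb{P}[X\in\mathscr{S}]\ge\eta$ that is centered (with respect to $X$, $\eta$ and $\delta$), then $\mathscr{S}$ minimizes $$\mathbb{E}\left[\left|X-\widehat{X}_{\mathscr{A}}\right| \,\middle|\, X\in\mathscr{A}\right]$$ over all silence sets $\mathscr{A}$ with $\mathbb{P}[X\in\mathscr{A}]\ge\eta$.
   Context: A silence set is a measurable set $\mathscr{A}\subseteq\mathbb{R}$. A density is logarithmically concave if its logarithm is a concave function over its support. For a silence set $\mathscr{A}$ the best estimate under silence is $\widehat{X}_{\mathscr{A}} = \arg\min_{y\in\mathbb{R}} \mathbb{E}[\delta(X-y)\mid X\in\mathscr{A}]$; for $\delta(x)=|x|$ this is the median of $X$ conditioned on $X\in\mathscr{A}$. Centering: given a silence set $\mathscr{S}$, let $\alpha_\eta = \inf\{\alpha\ge 0 : \mathbb{P}[\delta(X-\widehat{X}_{\mathscr{S}})\le\alpha]\ge\eta\}$ and define the centering of $\mathscr{S}$ as $\mathscr{S}_{\mathrm{cen.}} = \{x\in\mathbb{R} : \delta(x-\widehat{X}_{\mathscr{S}})\le\alpha_\eta\}$, i.e. the smallest sub-level set of $\delta(\cdot-\widehat{X}_{\mathscr{S}})$ with probability mass no less than $\eta$. A set $\mathscr{S}$ is called centered if it equals its centering or differs from it by a set of probability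 zero; the paper expresses this as $\mathbb{P}[X\in\mathscr{S}\setminus\mathscr{S}_{\mathrm{cen.}}]=0$. *)

theory Defs
  imports "HOL-Probability.Probability"
begin

text \<open>
  \<^term>\<open>concave_on\<close> includes convexity of its domain, so the set where the density is positive is
  an interval. The support is read as this set because the logarithm is finite exactly there.
\<close>
definition log_concave_density :: "(real \<Rightarrow> real) \<Rightarrow> bool" where
  "log_concave_density f \<longleftrightarrow> (\<forall>x. 0 \<le> f x) \<and> concave_on {x. 0 < f x} (\<lambda>x. ln (f x))"

text \<open>
  The conditional mean distortion $E[\delta(X - y) \mid X \in A]$ of a nonnegative distortion
  $\delta$, with values in $[0,\infty]$ so that no integrability assumption is needed.
  If $X \in A$ has probability zero, the value is $0$.
\<close>
definition cond_mean_distortion ::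
  "'a measure \<Rightarrow> ('a \<Rightarrow> real) \<Rightarrow> (real \<Rightarrow> real) \<Rightarrow> real set \<Rightarrow> real \<Rightarrow> ennreal" where
  "cond_mean_distortion M X \<delta> A y =
     (\<integral>\<^sup>+\<omega>. ennreal (\<delta> (X \<omega> - y)) \<partial>uniform_measure M {\<omega> \<in> space M. X \<omega> \<in> A})"

text \<open>If the minimizer is not unique, \<^term>\<open>arg_min\<close> selects an arbitrary one.\<close>
definition best_estimate ::
  "'a measure \<Rightarrow> ('a \<Rightarrow> real) \<Rightarrow> (real \<Rightarrow> real) \<Rightarrow> real set \<Rightarrow> real" where
  "best_estimate M X \<delta> A = (ARG_MIN (cond_mean_distortion M X \<delta> A) y. True)"

definition estimation_error ::
  "'a measure \<Rightarrow> ('a \<Rightarrow> real) \<Rightarrow> (real \<Rightarrow> real) \<Rightarrow> real set \<Rightarrow> ennreal" where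
  "estimation_error M X \<delta> A = cond_mean_distortion M X \<delta> A (best_estimate M X \<delta> A)"

text \<open>
  An extended real: for $\eta = 1$ and unbounded $X$ the set of admissible radii can be empty,
  and then the radius is $\infty$ and the centering is the whole real line.
\<close>
definition centering_radius ::
  "'a measure \<Rightarrow> ('a \<Rightarrow> real) \<Rightarrow> (real \<Rightarrow> real) \<Rightarrow> real \<Rightarrow> real set \<Rightarrow> ereal" where
  "centering_radius M X \<delta> \<eta> S =
     Inf (ereal ` {\<alpha>. 0 \<le> \<alpha> \<and> \<eta> \<le> \<P>(\<omega> in M. \<delta> (X \<omega> - best_estimate M X \<delta> S) \<le> \<alpha>)})"

definition centering ::
  "'a measure \<Rightarrow> ('a \<Rightarrow> real) \<Rightarrow> (real \<Rightarrow> real) \<Rightarrow> real \<Rightarrow> real set \<Rightarrow> real set" where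
  "centering M X \<delta> \<eta> S =
     {x. ereal (\<delta> (x - best_estimate M X \<delta> S)) \<le> centering_radius M X \<delta> \<eta> S}"

text \<open>
  Only the one-sided difference is required to be null. A set of probability at least $\eta$ whose
  centering has probability exactly $\eta$ then agrees with its centering up to a null set.
\<close>
definition centered ::
  "'a measure \<Rightarrow> ('a \<Rightarrow> real) \<Rightarrow> (real \<Rightarrow> real) \<Rightarrow> real \<Rightarrow> real set \<Rightarrow> bool" where
  "centered M X \<delta> \<eta> S \<longleftrightarrow> \<P>(\<omega> in M. X \<omega> \<in> S - centering M X \<delta> \<eta> S) = 0"

definition admissible_silence_set ::
  "'a measure \<Rightarrow> ('a \<Rightarrow> real) \<Rightarrow> real \<Rightarrow> real set \<Rightarrow> bool" where
  "admissible_silence_set M X \<eta> A \<longleftrightarrow> A \<in> sets borel \<and> \<eta> \<le> \<P>(\<omega> in M. X \<omega> \<in> A)"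

end

theory Submission
  imports Defs
begin

text \<open>
  Fix a set $A$ of probability at least $\eta$ and any estimate $y$ for it. Among all sets of probability at
  least $\eta$ the conditional mean of $|X - y|$ is smallest on a ball around $y$ of mass exactly
  $\eta$, because a ball is a sublevel set of the distance (\<open>mean_over_sublevel_set_le\<close>). On the
  other side, for $0 \le \eta < 1$ a centered set $S$ agrees up to a null set with a ball of mass $\eta$ around its own
  best estimate $m$ (\<open>centered_eq_ball_AE\<close>). So for $0 < \eta < 1$ two balls of mass $\eta$ have to be compared, one of
  which is centered at its own median. For $\eta = 0$ the error of $S$ is zero, and for $\eta = 1$ all
  admissible sets agree up to null sets.

  The comparison uses the quantile function $Q$ of $X$. Let $\eta = 2h$. The interval with mass
  coordinates $[s, s + 2h]$ has the median $Q(s + h)$, and the integral of the distance to it is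
  \[ J(s) = \int_0^h (Q(s + h + t) - Q(s + t))\,dt . \]
  Its derivative is $J'(s) = Q(s + 2h) - 2 Q(s + h) + Q(s)$. For a log-concave density $f$ the function
  $f \circ Q$ is concave (\<open>log_concave_increment_le\<close>), so $Q' = 1 / (f \circ Q)$ is convex
  (\<open>reciprocal_density_mass_midpoint\<close>) and $J'$ is nondecreasing. For a ball $[m - a, m + a]$ inside
  the support with median $m$ the value of $J'$ is $(m + a) - 2m + (m - a) = 0$. A convex function is
  minimal where its derivative vanishes, so this ball is the best interval of its mass
  (\<open>deviation_gap_le_of_shift_right\<close>, \<open>abs_deviation_centered_ball_le\<close>). If the support cuts the ball
  at one end, the interval already starts or ends where the support does; then other intervals lie on
  one side of it only, and a one-sided sign of $J'$ is enough.
\<close>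

section \<open>Log-concave densities in the mass coordinate\<close>

text \<open>
With $F$ as coordinate in place of $x$, the function $f \circ F^{-1}$ has derivative $(\ln f)'$,
which is nonincreasing, so it is concave; the inequality is its tangent line at $F(y)$. To do
without differentiability, let $k$ be the slope of a line that supports $\ln f$ at $y$. Then
$\rho(x) = f(x) e^{-kx}$ is nondecreasing before $y$ and nonincreasing after $y$, and $k F - f$ is
compared with the exact exponential case, where $\rho$ is constant and $k F - f$ is constant too.
\<close>
lemma log_concave_increment_le:
  fixes f F :: "real \<Rightarrow> real"
  assumes pos: "\<And>x. x \<in> {u<..<v} \<Longrightarrow> 0 < f x"
    and conc: "concave_on {u<..<v} (\<lambda>x. ln (f x))"
    and der: "\<And>x. x \<in> {u<..<v} \<Longrightarrow> (F has_real_derivative f x) (at x)"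
    and y: "y \<in> {u<..<v}"
  obtains k where "\<And>z. z \<in> {u<..<v} \<Longrightarrow> f z - f y \<le> k * (F z - F y)"
proof -
  let ?I = "{u<..<v}"
  have conv: "convex_on ?I (\<lambda>x. - ln (f x))"
    using conc by (simp add: concave_on_def)
  define k where
    "k = - Inf ((\<lambda>t. (- ln (f y) - - ln (f t)) / (y - t)) ` ({y<..} \<inter> ?I))"
  have tangent: "ln (f z) - k * z \<le> ln (f y) - k * y" if "z \<in> ?I" for z
    using convex_le_Inf_differential[OF conv _ that, of y] y
    by (simp add: k_def interior_open algebra_simps)
  define \<rho> where "\<rho> z = f z * exp (- k * z)" for z
  have f_eq: "f z = \<rho> z * exp (k * z)" for z
    by (simp add: \<rho>_def mult.assoc flip: exp_add)
  have \<rho>_ln: "\<rho> z = exp (ln (f z) - k * z)" if "z \<in> ?I" for z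
    using pos[OF that] by (simp add: \<rho>_def exp_diff exp_minus divide_inverse)
  have unimodal: "\<rho> z \<le> \<rho> x" if z: "z \<in> ?I" and x: "x \<in> closed_segment y z" for x z
  proof -
    obtain t where t: "0 \<le> t" "t \<le> 1" and xt: "x = (1 - t) * y + t * z"
      using x by (auto simp: closed_segment_def)
    have xI: "x \<in> ?I"
      using x closed_segment_subset[of y ?I z] y z convex_real_interval(8) by blast
    have "(1 - t) * ln (f y) + t * ln (f z) \<le> ln (f x)"
      using convex_onD[OF conv t y z] by (simp add: xt)
    moreover have "(1 - t) * (ln (f z) - k * z) \<le> (1 - t) * (ln (f y) - k * y)"
      using tangent[OF z] t by (intro mult_left_mono) auto
    ultimately have "ln (f z) - k * z \<le> ln (f x) - k * x"
      by (simp add: xt algebra_simps)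
    then show ?thesis
      using \<rho>_ln[OF z] \<rho>_ln[OF xI] by simp
  qed
  have exp_der: "((\<lambda>x. k * F x - C * exp (k * x)) has_real_derivative
      k * (\<rho> x - C) * exp (k * x)) (at x)" if "x \<in> ?I" for x C
    by (rule derivative_eq_intros der[OF that] refl)+ (simp add: f_eq algebra_simps)
  have exp_mono: "\<rho> p * exp (k * q) \<le> \<rho> p' * exp (k * q)" if "\<rho> p \<le> \<rho> p'" for p p' q
    using that by (intro mult_right_mono) auto
  have main: "f z - f y \<le> k * (F z - F y)" if z: "z \<in> ?I" for z
  proof (cases "y \<le> z")
    case True
    \<comment> \<open>The sign of \<^term>\<open>k\<close> decides which end of the interval makes
      \<^term>\<open>k * F x - C * exp (k * x)\<close> monotone.\<close>
    define C where "C = (if 0 \<le> k then \<rho> z else \<rho> y)"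
    have mono: "k * F y - C * exp (k * y) \<le> k * F z - C * exp (k * z)"
    proof (rule DERIV_nonneg_imp_nondecreasing[OF True])
      fix x assume x: "y \<le> x" "x \<le> z"
      then have xI: "x \<in> ?I" using y z by auto
      have "\<rho> z \<le> \<rho> x" "\<rho> x \<le> \<rho> y"
        using unimodal[OF z, of x] unimodal[OF xI, of y] x by (auto simp: closed_segment_eq_real_ivl)
      then have "0 \<le> k * (\<rho> x - C) * exp (k * x)"
        by (auto simp: C_def zero_le_mult_iff)
      then show "\<exists>d. ((\<lambda>x. k * F x - C * exp (k * x)) has_real_derivative d) (at x) \<and> 0 \<le> d"
        using exp_der[OF xI] by blast
    qed
    have "\<rho> z \<le> \<rho> y"
      using unimodal[OF z, of y] True by auto
    moreover have "C = \<rho> y \<or> C = \<rho> z"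
      by (simp add: C_def)
    ultimately show ?thesis
      using mono exp_mono[OF \<open>\<rho> z \<le> \<rho> y\<close>, of y] exp_mono[OF \<open>\<rho> z \<le> \<rho> y\<close>, of z]
      unfolding f_eq[of z] f_eq[of y] right_diff_distrib
      by (elim disjE) (hypsubst, linarith)+
  next
    case False
    then have zy: "z \<le> y" by simp
    define C where "C = (if 0 \<le> k then \<rho> y else \<rho> z)"
    have mono: "- (k * F z - C * exp (k * z)) \<le> - (k * F y - C * exp (k * y))"
    proof (rule DERIV_nonneg_imp_nondecreasing[OF zy])
      fix x assume x: "z \<le> x" "x \<le> y"
      then have xI: "x \<in> ?I" using y z by auto
      have "\<rho> z \<le> \<rho> x" "\<rho> x \<le> \<rho> y"
        using unimodal[OF z, of x] unimodal[OF xI, of y] x by (auto simp: closed_segment_eq_real_ivl)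
      then have "k * (\<rho> x - C) * exp (k * x) \<le> 0"
        by (auto simp: C_def mult_le_0_iff)
      then show "\<exists>d. ((\<lambda>x. - (k * F x - C * exp (k * x))) has_real_derivative d) (at x) \<and> 0 \<le> d"
        using DERIV_minus[OF exp_der[OF xI]] by (metis neg_0_le_iff_le)
    qed
    have "\<rho> z \<le> \<rho> y"
      using unimodal[OF z, of y] zy by auto
    moreover have "C = \<rho> y \<or> C = \<rho> z"
      by (simp add: C_def)
    ultimately show ?thesis
      using mono exp_mono[OF \<open>\<rho> z \<le> \<rho> y\<close>, of y] exp_mono[OF \<open>\<rho> z \<le> \<rho> y\<close>, of z]
      unfolding f_eq[of z] f_eq[of y] right_diff_distrib
      by (elim disjE) (hypsubst, linarith)+
  qed
  then show thesis by (rule that)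
qed

text \<open>
The derivative of the quantile function is $q = 1 / (f \circ F^{-1})$. The inequality is the midpoint
convexity of $q$: the tangent line of the concave $f \circ F^{-1}$ at $F(y)$ gives
$f(x) + f(z) \le 2 f(y)$, and the harmonic mean is at most the arithmetic mean.
\<close>
lemma reciprocal_density_mass_midpoint:
  fixes f F :: "real \<Rightarrow> real"
  assumes pos: "\<And>x. x \<in> {u<..<v} \<Longrightarrow> 0 < f x"
    and conc: "concave_on {u<..<v} (\<lambda>x. ln (f x))"
    and der: "\<And>x. x \<in> {u<..<v} \<Longrightarrow> (F has_real_derivative f x) (at x)"
    and xyz: "x \<in> {u<..<v}" "y \<in> {u<..<v}" "z \<in> {u<..<v}"
    and mid: "F z - F y = F y - F x"
  shows "2 / f y \<le> 1 / f x + 1 / f z"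
proof -
  obtain k where k: "\<And>z. z \<in> {u<..<v} \<Longrightarrow> f z - f y \<le> k * (F z - F y)"
    using log_concave_increment_le[OF pos conc der xyz(2)] by blast
  have "k * (F z - F y) = - (k * (F x - F y))"
    using mid by (metis minus_diff_eq mult_minus_right)
  then have sum: "f x + f z \<le> 2 * f y"
    using k[OF xyz(1)] k[OF xyz(3)] by linarith
  have p: "0 < f x" "0 < f y" "0 < f z"
    using pos xyz by auto
  have "2 / f y \<le> 4 / (f x + f z)"
    using sum p by (simp add: field_simps)
  also have "\<dots> \<le> 1 / f x + 1 / f z"
  proof -
    have "0 \<le> (f x - f z)\<^sup>2" by simp
    then have "4 * (f x * f z) \<le> (f x + f z) * (f x + f z)"
      by (simp add: power2_eq_square algebra_simps)
    then show ?thesis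
      using p by (simp add: divide_simps add_pos_pos) (simp add: algebra_simps)
  qed
  finally show ?thesis .
qed

text \<open>
The derivative of the second difference of $R$ is the second difference of $Q$, which is
nondecreasing because the second difference of $q$ is nonnegative. So it stays nonnegative once
it starts so.
\<close>
lemma second_difference_mono:
  fixes R Q q :: "real \<Rightarrow> real"
  assumes h: "0 \<le> h" and ab: "a \<le> b"
    and contR: "continuous_on {a..b + 2 * h} R" and contQ: "continuous_on {a..b + 2 * h} Q"
    and derR: "\<And>s. s \<in> {a<..<b + 2 * h} \<Longrightarrow> (R has_real_derivative Q s) (at s)"
    and derQ: "\<And>s. s \<in> {a<..<b + 2 * h} \<Longrightarrow> (Q has_real_derivative q s) (at s)"
    and mid: "\<And>s. s \<in> {a<..<b} \<Longrightarrow> 2 * q (s + h) \<le> q s + q (s + 2 * h)"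
    and start: "0 \<le> Q (a + 2 * h) - 2 * Q (a + h) + Q a"
  shows "R (a + 2 * h) - 2 * R (a + h) + R a \<le> R (b + 2 * h) - 2 * R (b + h) + R b"
proof -
  define D where "D g s = g (s + 2 * h) - 2 * g (s + h) + g s" for g :: "real \<Rightarrow> real" and s
  have contD: "continuous_on {a..b} (D g)" if g: "continuous_on {a..b + 2 * h} g" for g
    unfolding D_def
    by (intro continuous_intros continuous_on_compose2[OF g]) (use h in auto)
  have shift: "((\<lambda>s. g (s + c)) has_real_derivative g' (s + c)) (at s)"
    if "\<And>t. t \<in> {a<..<b + 2 * h} \<Longrightarrow> (g has_real_derivative g' t) (at t)"
      "s \<in> {a<..<b}" "0 \<le> c" "c \<le> 2 * h" for g g' :: "real \<Rightarrow> real" and s c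
    using that(1)[of "s + c"] that(2-) by (simp add: DERIV_shift)
  have derD: "(D g has_real_derivative D g' s) (at s)"
    if g: "\<And>t. t \<in> {a<..<b + 2 * h} \<Longrightarrow> (g has_real_derivative g' t) (at t)"
      and s: "s \<in> {a<..<b}" for g g' s
    unfolding D_def
    using shift[OF g s, of "2 * h"] shift[OF g s, of h] shift[OF g s, of 0] h
    by (auto intro!: derivative_eq_intros)
  have DQ: "0 \<le> D Q s" if s: "s \<in> {a..b}" for s
  proof -
    have "D Q a \<le> D Q s"
    proof (rule DERIV_nonneg_imp_increasing_open[of a s "D Q"])
      show "a \<le> s" using s by simp
      show "continuous_on {a..s} (D Q)"
        by (rule continuous_on_subset[OF contD[OF contQ]]) (use s in auto)
      fix t assume "a < t" "t < s"
      then have t: "t \<in> {a<..<b}" using s by auto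
      show "\<exists>d. (D Q has_real_derivative d) (at t) \<and> 0 \<le> d"
        using derD[OF derQ t] mid[OF t] by (auto simp: D_def intro!: exI[of _ "D q t"])
    qed
    then show ?thesis using start by (simp add: D_def)
  qed
  have "D R a \<le> D R b"
  proof (rule DERIV_nonneg_imp_increasing_open[OF ab _ contD[OF contR]])
    fix t assume "a < t" "t < b"
    then show "\<exists>d. (D R has_real_derivative d) (at t) \<and> 0 \<le> d"
      using derD[OF derR, of t] DQ[of t] by auto
  qed
  then show ?thesis by (simp add: D_def)
qed

section \<open>Integrals of a density over intervals\<close>

text \<open>
Densities need not be bounded near the ends of the support, so integrability of the first moments on
an interval comes from the boundedness of the other factor.
\<close>
lemma set_integrable_continuous_mult:
  fixes f g :: "real \<Rightarrow> real"
  assumes f: "integrable lborel f" and g: "continuous_on {a..b} g"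
  shows "set_integrable lborel {a..b} (\<lambda>x. g x * f x)"
proof -
  have "compact (g ` {a..b})"
    using g by (intro compact_continuous_image) auto
  then obtain K where K: "\<And>x. x \<in> {a..b} \<Longrightarrow> \<bar>g x\<bar> \<le> K"
    unfolding compact_eq_bounded_closed bounded_iff by (metis image_eqI real_norm_def)
  have gm: "(\<lambda>x. indicator {a..b} x *\<^sub>R g x) \<in> borel_measurable borel"
    using borel_measurable_continuous_on_indicator[OF _ g] by simp
  have "integrable lborel (\<lambda>x. (indicator {a..b} x *\<^sub>R g x) * f x)"
  proof (rule Bochner_Integration.integrable_bound)
    show "integrable lborel (\<lambda>x. K * \<bar>f x\<bar>)"
      using f by simp
    show "(\<lambda>x. (indicator {a..b} x *\<^sub>R g x) * f x) \<in> borel_measurable lborel"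
      using gm f by (intro borel_measurable_times) auto
    have "norm (indicator {a..b} x *\<^sub>R g x * f x) \<le> norm (K * \<bar>f x\<bar>)" for x
    proof (cases "x \<in> {a..b}")
      case True
      then have "\<bar>g x\<bar> * \<bar>f x\<bar> \<le> K * \<bar>f x\<bar>"
        using K by (intro mult_right_mono) auto
      then show ?thesis
        using True K[OF True] by (simp add: abs_mult)
    qed simp
    then show "AE x in lborel. norm (indicator {a..b} x *\<^sub>R g x * f x) \<le> norm (K * \<bar>f x\<bar>)"
      by simp
  qed
  then show ?thesis
    by (simp add: set_integrable_def mult.assoc)
qed

lemma continuous_mult_integrable_on:
  fixes f g :: "real \<Rightarrow> real"
  assumes "integrable lborel f" "continuous_on {a..b} g"
  shows "(\<lambda>x. g x * f x) integrable_on {a..b}"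
  using set_borel_integral_eq_integral(1)[OF set_integrable_continuous_mult[OF assms]] .

lemma density_integrable_on:
  fixes f :: "real \<Rightarrow> real"
  assumes "integrable lborel f"
  shows "f integrable_on {a..b}"
  using continuous_mult_integrable_on[OF assms, of a b "\<lambda>_. 1"] by simp

lemma indefinite_integral_derivative:
  fixes g :: "real \<Rightarrow> real"
  assumes g: "g integrable_on {u..v}" and cont: "continuous_on {u<..<v} g" and x: "x \<in> {u<..<v}"
  shows "((\<lambda>x. integral {u..x} g) has_real_derivative g x) (at x)"
proof -
  have at_x: "at x within {u..v} = at x"
    using x by (intro at_within_interior) auto
  have "isCont g x"
    using cont x continuous_on_eq_continuous_at[OF open_greaterThanLessThan] by blast
  then show ?thesis
    using integral_has_vector_derivative_continuous_at[of g u v x "{}"] g x at_x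
    by (auto simp: has_real_derivative_iff_has_vector_derivative)
qed

lemma log_concave_continuous_on:
  fixes f :: "real \<Rightarrow> real"
  assumes pos: "\<And>x. x \<in> {u<..<v} \<Longrightarrow> 0 < f x" and conc: "concave_on {u<..<v} (\<lambda>x. ln (f x))"
  shows "continuous_on {u<..<v} f"
proof -
  have "continuous_on {u<..<v} (\<lambda>x. - ln (f x))"
    using conc by (intro convex_on_continuous) (auto simp: concave_on_def)
  from continuous_on_exp[OF continuous_on_minus[OF this]]
  show ?thesis
    by (rule continuous_on_eq) (use pos in simp)
qed

lemma integral_density_strict_mono:
  fixes f :: "real \<Rightarrow> real"
  assumes f: "integrable lborel f" and pos: "\<And>x. x \<in> {u<..<v} \<Longrightarrow> 0 < f x"
    and conc: "concave_on {u<..<v} (\<lambda>x. ln (f x))"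
    and xy: "u \<le> x" "x < y" "y \<le> v"
  shows "integral {u..x} f < integral {u..y} f"
proof (rule DERIV_pos_imp_increasing_open[OF xy(2)])
  fix t assume t: "x < t" "t < y"
  then have "t \<in> {u<..<v}" using xy by auto
  then show "\<exists>d. ((\<lambda>x. integral {u..x} f) has_real_derivative d) (at t) \<and> 0 < d"
    using indefinite_integral_derivative[OF density_integrable_on[OF f]
        log_concave_continuous_on[OF pos conc]] pos by blast
next
  show "continuous_on {x..y} (\<lambda>x. integral {u..x} f)"
    by (rule continuous_on_subset[OF indefinite_integral_continuous_1[OF density_integrable_on[OF f]]])
      (use xy in auto)
qed

lemma integral_density_pos:
  fixes f :: "real \<Rightarrow> real"
  assumes f: "integrable lborel f" and pos: "\<And>x. x \<in> {u<..<v} \<Longrightarrow> 0 < f x"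
    and conc: "concave_on {u<..<v} (\<lambda>x. ln (f x))"
    and xy: "u \<le> x" "x < y" "y \<le> v"
  shows "0 < integral {x..y} f"
proof -
  have "integral {u..x} f + integral {x..y} f = integral {u..y} f"
    using xy by (intro Henstock_Kurzweil_Integration.integral_combine density_integrable_on[OF f]) auto
  then show ?thesis
    using integral_density_strict_mono[OF f pos conc xy] by simp
qed

text \<open>
The point \<^term>\<open>m\<close> halves the mass of $[u, v]$ and \<^term>\<open>c\<close> that of $[w, z]$, so the two sides are
the integrals of $|x - m| f(x)$ and $|x - c| f(x)$ over these intervals. Let $Q$ be the inverse of
$F(x) = \int_u^x f$ and let $R(s) = \int_u^{Q(s)} x f(x)\,dx$, so that $R' = Q$. For an interval whose mass
coordinates are $[s, s + 2h]$ this integral is the second difference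
$R(s + 2h) - 2 R(s + h) + R(s)$, and its derivative in $s$ is the second difference of $Q$. At the
start this is $(v - m) - (m - u) \ge 0$, and log-concavity keeps it nonnegative.

Only an inequality between the two halves is assumed, because the left half may be cut short by the
end of the support.
\<close>
section \<open>Shifting an interval of constant mass\<close>

lemma deviation_gap_le_of_shift_right:
  fixes f :: "real \<Rightarrow> real"
  assumes f: "integrable lborel f" and pos: "\<And>x. x \<in> {u<..<z} \<Longrightarrow> 0 < f x"
    and conc: "concave_on {u<..<z} (\<lambda>x. ln (f x))"
    and order: "u \<le> m" "m \<le> v" "v \<le> z" "u \<le> w" "w \<le> c" "c \<le> z"
    and mass: "integral {u..m} f = h" "integral {m..v} f = h" "integral {w..c} f = h" "integral {c..z} f = h"
    and lean: "m - u \<le> v - m"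
  shows "integral {m..v} (\<lambda>x. x * f x) - integral {u..m} (\<lambda>x. x * f x)
       \<le> integral {c..z} (\<lambda>x. x * f x) - integral {w..c} (\<lambda>x. x * f x)"
proof -
  define F where "F x = integral {u..x} f" for x
  define H where "H x = integral {u..x} (\<lambda>x. x * f x)" for x
  define Q where "Q = inv_into {u..z} F"
  define p where "p = F w"
  have uz: "u \<le> z" using order by simp
  have fint: "f integrable_on {a..b}" for a b
    by (rule density_integrable_on[OF f])
  have xfint: "(\<lambda>x. x * f x) integrable_on {a..b}" for a b
    by (rule continuous_mult_integrable_on[OF f]) (intro continuous_intros)
  have contf: "continuous_on {u<..<z} f"
    by (rule log_concave_continuous_on[OF pos conc])
  have contF: "continuous_on {u..z} F" and contH: "continuous_on {u..z} H"
    unfolding F_def H_def by (rule indefinite_integral_continuous_1 fint xfint)+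
  have derF: "(F has_real_derivative f x) (at x)" if "x \<in> {u<..<z}" for x
    unfolding F_def by (rule indefinite_integral_derivative[OF fint contf that])
  have derH: "(H has_real_derivative x * f x) (at x)" if "x \<in> {u<..<z}" for x
    unfolding H_def
    by (rule indefinite_integral_derivative[OF xfint _ that]) (intro continuous_intros contf)
  have Fless: "F x < F y" if "u \<le> x" "x < y" "y \<le> z" for x y
    unfolding F_def by (rule integral_density_strict_mono[OF f pos conc that])
  have inj: "inj_on F {u..z}"
    using Fless by (intro linorder_inj_onI) fastforce+
  have Fle: "F x \<le> F y" if "u \<le> x" "x \<le> y" "y \<le> z" for x y
    using Fless[of x y] that by (cases "x = y") auto
  have diffF: "integral {x..y} f = F y - F x" and diffH: "integral {x..y} (\<lambda>x. x * f x) = H y - H x"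
    if "u \<le> x" "x \<le> y" for x y
    using Henstock_Kurzweil_Integration.integral_combine[OF that fint]
      Henstock_Kurzweil_Integration.integral_combine[OF that xfint]
    by (simp_all add: F_def H_def)
  have Fu: "F u = 0" by (simp add: F_def)
  have F_vals: "F m = h" "F v = 2 * h" "F c = p + h" "F z = p + 2 * h"
    using mass diffF order Fu by (auto simp: p_def)
  have p0: "0 \<le> p" and h0: "0 \<le> h"
    using Fle[of u w] Fle[of u m] order Fu F_vals by (auto simp: p_def)
  have image: "F ` {u..z} = {0..p + 2 * h}"
  proof
    show "F ` {u..z} \<subseteq> {0..p + 2 * h}"
      using Fle[of u] Fle[of _ z] uz Fu F_vals by force
    show "{0..p + 2 * h} \<subseteq> F ` {u..z}"
      using IVT'[of F u _ z] uz Fu F_vals contF by force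
  qed
  have FQ: "F (Q s) = s" and Q_mem: "Q s \<in> {u..z}" if "s \<in> {0..p + 2 * h}" for s
    using that f_inv_into_f[of s F "{u..z}"] inv_into_into[of s F "{u..z}"]
    unfolding image Q_def by auto
  have QF: "Q (F x) = x" if "x \<in> {u..z}" for x
    unfolding Q_def using inj that by simp
  have contQ: "continuous_on {0..p + 2 * h} Q"
    using continuous_on_inv[OF contF _, of Q] QF image by auto
  have Q_open: "Q s \<in> {u<..<z}" if s: "s \<in> {0<..<p + 2 * h}" for s
  proof -
    have "Q s \<noteq> u" "Q s \<noteq> z"
      using FQ[of s] s Fu F_vals by auto
    then show ?thesis
      using Q_mem[of s] s by auto
  qed
  have derQ: "(Q has_real_derivative 1 / f (Q s)) (at s)" if s: "s \<in> {0<..<p + 2 * h}" for s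
  proof -
    have "isCont Q s"
      using contQ s by (intro continuous_on_interior[of "{0..p + 2 * h}"]) auto
    then have "(Q has_real_derivative inverse (f (Q s))) (at s)"
      using s derF[OF Q_open[OF s]] pos[OF Q_open[OF s]] FQ
      by (intro DERIV_inverse_function[where f = F and a = 0 and b = "p + 2 * h"]) auto
    then show ?thesis by (simp add: divide_inverse)
  qed
  have derR: "((\<lambda>s. H (Q s)) has_real_derivative Q s) (at s)" if s: "s \<in> {0<..<p + 2 * h}" for s
    using DERIV_chain2[OF derH[OF Q_open[OF s]] derQ[OF s]] pos[OF Q_open[OF s]]
    by simp
  have contR: "continuous_on {0..p + 2 * h} (\<lambda>s. H (Q s))"
    by (rule continuous_on_compose2[OF contH contQ]) (use Q_mem in auto)
  have mid: "2 * (1 / f (Q (s + h))) \<le> 1 / f (Q s) + 1 / f (Q (s + 2 * h))" if s: "s \<in> {0<..<p}" for s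
    using reciprocal_density_mass_midpoint[OF pos conc derF Q_open[of s] Q_open[of "s + h"] Q_open[of "s + 2 * h"]]
      s h0 FQ by simp
  have Q_vals: "Q 0 = u" "Q h = m" "Q (2 * h) = v" "Q p = w" "Q (p + h) = c" "Q (p + 2 * h) = z"
    using QF[of u] QF[of m] QF[of v] QF[of w] QF[of c] QF[of z] order F_vals Fu
    by (auto simp: p_def)
  have "H (Q (0 + 2 * h)) - 2 * H (Q (0 + h)) + H (Q 0)
      \<le> H (Q (p + 2 * h)) - 2 * H (Q (p + h)) + H (Q p)"
  proof (rule second_difference_mono[OF h0 p0 contR contQ derR derQ mid])
    show "0 \<le> Q (0 + 2 * h) - 2 * Q (0 + h) + Q 0"
      using lean by (simp add: Q_vals)
  qed auto
  then show ?thesis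
    using order by (simp add: Q_vals diffH)
qed

section \<open>Support and reflection of a log-concave density\<close>

lemma log_concave_density_reflect:
  assumes "log_concave_density f"
  shows "log_concave_density (\<lambda>x. f (- x))"
proof -
  have nonneg: "0 \<le> f x" for x
    using assms by (simp add: log_concave_density_def)
  have conv: "convex_on {x. 0 < f x} (\<lambda>x. - ln (f x))"
    using assms by (simp add: log_concave_density_def concave_on_def)
  have "convex_on {x. 0 < f (- x)} (\<lambda>x. - ln (f (- x)))"
  proof (rule convex_onI)
    fix t x y :: real
    assume t: "0 < t" "t < 1" and xy: "x \<in> {x. 0 < f (- x)}" "y \<in> {x. 0 < f (- x)}"
    have eq: "- ((1 - t) *\<^sub>R x + t *\<^sub>R y) = (1 - t) *\<^sub>R (- x) + t *\<^sub>R (- y)"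
      by simp
    show "- ln (f (- ((1 - t) *\<^sub>R x + t *\<^sub>R y))) \<le> (1 - t) * (- ln (f (- x))) + t * (- ln (f (- y)))"
      unfolding eq using convex_onD[OF conv, of t "- x" "- y"] t xy by simp
  next
    have "{x. 0 < f (- x)} = uminus ` {x. 0 < f x}"
      by (force simp: image_iff)
    then show "convex {x. 0 < f (- x)}"
      using convex_negations convex_on_imp_convex[OF conv] by simp
  qed
  then show ?thesis
    using nonneg by (simp add: log_concave_density_def concave_on_def)
qed

text \<open>
The later arguments take place on an open interval of positivity, where concavity of the logarithm
also yields continuity.
\<close>
lemma log_concave_density_concave_on_interval:
  assumes "log_concave_density f" and "\<And>x. x \<in> {u<..<v} \<Longrightarrow> 0 < f x"
  shows "concave_on {u<..<v} (\<lambda>x. ln (f x))"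
proof -
  have "convex_on {u<..<v} (\<lambda>x. - ln (f x))"
    by (rule convex_on_subset[of "{x. 0 < f x}"])
      (use assms in \<open>auto simp: log_concave_density_def concave_on_def\<close>)
  then show ?thesis
    by (simp add: concave_on_def)
qed

lemma log_concave_density_pos_between:
  assumes "log_concave_density f" and "0 < f x" "0 < f y" and "x \<le> z" "z \<le> y"
  shows "0 < f z"
proof -
  have "convex {x. 0 < f x}"
    using assms convex_on_imp_convex by (auto simp: log_concave_density_def concave_on_def)
  then have "z \<in> {x. 0 < f x}"
    using assms closed_segment_subset[of x "{x. 0 < f x}" y] by (auto simp: closed_segment_eq_real_ivl)
  then show ?thesis by simp
qed

lemma integrable_reflect:
  fixes f :: "real \<Rightarrow> real"
  assumes "integrable lborel f"
  shows "integrable lborel (\<lambda>x. f (- x))"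
  using lborel_integrable_real_affine[OF assms, of "-1" 0] by simp

lemma abs_deviation_reflect:
  fixes f :: "real \<Rightarrow> real"
  shows "integral {- v..- u} (\<lambda>x. \<bar>x - y\<bar> * f (- x)) = integral {u..v} (\<lambda>x. \<bar>x - (- y)\<bar> * f x)"
proof -
  have "integral {- v..- u} (\<lambda>x. \<bar>(- x) - (- y)\<bar> * f (- x)) = integral {u..v} (\<lambda>x. \<bar>x - (- y)\<bar> * f x)"
    by (rule Henstock_Kurzweil_Integration.integral_reflect_real)
  moreover have "\<bar>(- x) - (- y)\<bar> = \<bar>x - y\<bar>" for x by simp
  ultimately show ?thesis by simp
qed

section \<open>Medians and the mean absolute deviation\<close>

lemma abs_deviation_integrable_on:
  fixes f :: "real \<Rightarrow> real"
  assumes "integrable lborel f"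
  shows "(\<lambda>x. \<bar>x - y\<bar> * f x) integrable_on {a..b}"
  by (rule continuous_mult_integrable_on[OF assms]) (intro continuous_intros)

lemma median_exists:
  fixes f :: "real \<Rightarrow> real"
  assumes f: "integrable lborel f" and nonneg: "\<And>x. 0 \<le> f x" and lr: "l \<le> r"
  obtains c where "l \<le> c" "c \<le> r" "integral {l..c} f = integral {c..r} f"
proof -
  have fint: "f integrable_on {a..b}" for a b
    by (rule density_integrable_on[OF f])
  have half: "0 \<le> integral {l..r} f / 2" "integral {l..r} f / 2 \<le> integral {l..r} f"
    using integral_nonneg[OF fint] nonneg by simp_all
  obtain c where c: "l \<le> c" "c \<le> r" "integral {l..c} f = integral {l..r} f / 2"
    using IVT'[of "\<lambda>x. integral {l..x} f" l "integral {l..r} f / 2" r] lr half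
      indefinite_integral_continuous_1[OF fint] by auto
  then show thesis
    using that[of c] Henstock_Kurzweil_Integration.integral_combine[OF c(1,2) fint] by simp
qed

text \<open>
Bounding $|x - y|$ below by $\pm(x - y)$ with the sign of $x - c$ removes the dependence on $y$,
because the two halves have equal mass.
\<close>
lemma abs_deviation_ge_median:
  fixes f :: "real \<Rightarrow> real"
  assumes f: "integrable lborel f" and nonneg: "\<And>x. 0 \<le> f x"
    and c: "l \<le> c" "c \<le> r" "integral {l..c} f = integral {c..r} f"
  shows "integral {c..r} (\<lambda>x. x * f x) - integral {l..c} (\<lambda>x. x * f x)
      \<le> integral {l..r} (\<lambda>x. \<bar>x - y\<bar> * f x)"
    and "integral {l..r} (\<lambda>x. \<bar>x - c\<bar> * f x)
      = integral {c..r} (\<lambda>x. x * f x) - integral {l..c} (\<lambda>x. x * f x)"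
proof -
  have fint: "f integrable_on {a..b}" and xfint: "(\<lambda>x. x * f x) integrable_on {a..b}" for a b
    using continuous_mult_integrable_on[OF f, of a b "\<lambda>x. x"] density_integrable_on[OF f] by auto
  note aint = abs_deviation_integrable_on[OF f]
  have split: "integral {l..r} (\<lambda>x. \<bar>x - y\<bar> * f x)
      = integral {l..c} (\<lambda>x. \<bar>x - y\<bar> * f x) + integral {c..r} (\<lambda>x. \<bar>x - y\<bar> * f x)" for y
    using Henstock_Kurzweil_Integration.integral_combine[OF c(1,2) aint] by simp
  have lin: "((\<lambda>x. y * f x - x * f x) has_integral y * integral {a..b} f - integral {a..b} (\<lambda>x. x * f x)) {a..b}"
    for a b y
    by (intro has_integral_diff has_integral_mult_right integrable_integral fint xfint)
  have left: "y * integral {l..c} f - integral {l..c} (\<lambda>x. x * f x) \<le> integral {l..c} (\<lambda>x. \<bar>x - y\<bar> * f x)" for y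
  proof (rule has_integral_le[OF lin integrable_integral[OF aint]])
    fix x
    have "(y - x) * f x \<le> \<bar>x - y\<bar> * f x"
      using nonneg by (intro mult_right_mono) auto
    then show "y * f x - x * f x \<le> \<bar>x - y\<bar> * f x"
      by (simp add: left_diff_distrib)
  qed
  have right: "- (y * integral {c..r} f - integral {c..r} (\<lambda>x. x * f x)) \<le> integral {c..r} (\<lambda>x. \<bar>x - y\<bar> * f x)" for y
  proof (rule has_integral_le[OF has_integral_neg[OF lin] integrable_integral[OF aint]])
    fix x
    have "(x - y) * f x \<le> \<bar>x - y\<bar> * f x"
      using nonneg by (intro mult_right_mono) auto
    then show "- (y * f x - x * f x) \<le> \<bar>x - y\<bar> * f x"
      by (simp add: left_diff_distrib)
  qed
  show "integral {c..r} (\<lambda>x. x * f x) - integral {l..c} (\<lambda>x. x * f x)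
      \<le> integral {l..r} (\<lambda>x. \<bar>x - y\<bar> * f x)"
    using left[of y] right[of y] split[of y] c(3) by simp
  have "integral {l..c} (\<lambda>x. \<bar>x - c\<bar> * f x) = integral {l..c} (\<lambda>x. c * f x - x * f x)"
    by (rule integral_cong) (simp add: left_diff_distrib)
  moreover have "integral {c..r} (\<lambda>x. \<bar>x - c\<bar> * f x) = integral {c..r} (\<lambda>x. - (c * f x - x * f x))"
    by (rule integral_cong) (simp add: left_diff_distrib)
  ultimately show "integral {l..r} (\<lambda>x. \<bar>x - c\<bar> * f x)
      = integral {c..r} (\<lambda>x. x * f x) - integral {l..c} (\<lambda>x. x * f x)"
    using split[of c] integral_unique[OF lin[of c l c]] integral_unique[OF has_integral_neg[OF lin[of c c r]]] c(3)
    by simp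
qed

text \<open>
If $y$ were to the right of the median $c$, then between $c$ and a point $z < y$ the bound
$|x - y| \ge x - y$ would be off by at least $2(y - z)$, and the mass there is positive. So the
integral at $y$ would strictly exceed its value at $c$.
\<close>
lemma abs_deviation_minimizer_le_median:
  fixes f :: "real \<Rightarrow> real"
  assumes f: "integrable lborel f" and lc: "log_concave_density f"
    and pos: "\<And>x. x \<in> {l<..<r} \<Longrightarrow> 0 < f x"
    and c: "l \<le> c" "c < r" "integral {l..c} f = integral {c..r} f"
    and min: "integral {l..r} (\<lambda>x. \<bar>x - y\<bar> * f x) \<le> integral {l..r} (\<lambda>x. \<bar>x - c\<bar> * f x)"
  shows "y \<le> c"
proof (rule ccontr)
  assume "\<not> y \<le> c"
  then have yc: "c < y" by simp
  define z where "z = (c + min y r) / 2"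
  have z: "c < z" "z < y" "z \<le> r"
    using yc c by (auto simp: z_def min_def field_simps)
  have nonneg: "0 \<le> f x" for x
    using lc by (simp add: log_concave_density_def)
  note fint = density_integrable_on[OF f] and aint = abs_deviation_integrable_on[OF f]
  have split: "integral {l..r} (\<lambda>x. \<bar>x - y\<bar> * f x)
      = integral {l..c} (\<lambda>x. \<bar>x - y\<bar> * f x) + integral {c..z} (\<lambda>x. \<bar>x - y\<bar> * f x)
        + integral {z..r} (\<lambda>x. \<bar>x - y\<bar> * f x)" for y
    using Henstock_Kurzweil_Integration.integral_combine[of l c r "\<lambda>x. \<bar>x - y\<bar> * f x", OF _ _ aint]
      Henstock_Kurzweil_Integration.integral_combine[of c z r "\<lambda>x. \<bar>x - y\<bar> * f x", OF _ _ aint] c z by simp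
  have bound: "integral {a..b} (\<lambda>x. \<bar>x - c\<bar> * f x) + k * integral {a..b} f
      \<le> integral {a..b} (\<lambda>x. \<bar>x - y\<bar> * f x)"
    if "\<And>x. x \<in> {a..b} \<Longrightarrow> \<bar>x - c\<bar> + k \<le> \<bar>x - y\<bar>" for a b k
  proof (rule has_integral_le[OF has_integral_add[OF integrable_integral[OF aint]
          has_integral_mult_right[OF integrable_integral[OF fint]]] integrable_integral[OF aint]])
    fix x assume "x \<in> {a..b}"
    then have "(\<bar>x - c\<bar> + k) * f x \<le> \<bar>x - y\<bar> * f x"
      using that nonneg by (intro mult_right_mono) auto
    then show "\<bar>x - c\<bar> * f x + k * f x \<le> \<bar>x - y\<bar> * f x"
      by (simp add: distrib_right)
  qed
  have "integral {l..c} f = integral {c..z} f + integral {z..r} f"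
    using Henstock_Kurzweil_Integration.integral_combine[of c z r f, OF _ _ fint] c z by simp
  moreover have "integral {l..c} (\<lambda>x. \<bar>x - c\<bar> * f x) + (y - c) * integral {l..c} f
      \<le> integral {l..c} (\<lambda>x. \<bar>x - y\<bar> * f x)"
    by (rule bound) (use yc in auto)
  moreover have "integral {c..z} (\<lambda>x. \<bar>x - c\<bar> * f x) + (y + c - 2 * z) * integral {c..z} f
      \<le> integral {c..z} (\<lambda>x. \<bar>x - y\<bar> * f x)"
    by (rule bound) (use yc z in auto)
  moreover have "integral {z..r} (\<lambda>x. \<bar>x - c\<bar> * f x) + (c - y) * integral {z..r} f
      \<le> integral {z..r} (\<lambda>x. \<bar>x - y\<bar> * f x)"
    by (rule bound) (use yc z in auto)
  ultimately have "2 * (y - z) * integral {c..z} f \<le> 0"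
    using min split[of y] split[of c] by (simp add: algebra_simps)
  moreover have "0 < integral {c..z} f"
    using integral_density_pos[OF f pos log_concave_density_concave_on_interval[OF lc pos] c(1) z(1,3)] by simp
  ultimately show False
    using z by (simp add: mult_le_0_iff)
qed

text \<open>
Conversely to the minimality of the median: a positive density has only one median, and no other point
reaches the minimum. This identifies an arbitrarily chosen minimizer.
\<close>
lemma abs_deviation_minimizer_eq_median:
  fixes f :: "real \<Rightarrow> real"
  assumes f: "integrable lborel f" and lc: "log_concave_density f" and lr: "l < r"
    and pos: "\<And>x. x \<in> {l<..<r} \<Longrightarrow> 0 < f x"
    and c: "l \<le> c" "c \<le> r" "integral {l..c} f = integral {c..r} f"
    and min: "integral {l..r} (\<lambda>x. \<bar>x - y\<bar> * f x) \<le> integral {l..r} (\<lambda>x. \<bar>x - c\<bar> * f x)"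
  shows "y = c"
proof -
  note posI = integral_density_pos[OF f pos log_concave_density_concave_on_interval[OF lc pos], of l r]
  have "0 < integral {l..r} f"
    using posI[of l r] lr by simp
  then have c': "l < c" "c < r"
    using c by (force simp: less_le)+
  have "y \<le> c"
    by (rule abs_deviation_minimizer_le_median[OF f lc pos c(1) c'(2) c(3) min])
  moreover have "- y \<le> - c"
  proof (rule abs_deviation_minimizer_le_median[OF integrable_reflect[OF f] log_concave_density_reflect[OF lc]])
    show "- r \<le> - c" "- c < - l" using c c' by auto
    show "integral {- r..- c} (\<lambda>x. f (- x)) = integral {- c..- l} (\<lambda>x. f (- x))"
      using c(3) by simp
    show "integral {- r..- l} (\<lambda>x. \<bar>x - - y\<bar> * f (- x)) \<le> integral {- r..- l} (\<lambda>x. \<bar>x - - c\<bar> * f (- x))"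
      using min by (simp only: abs_deviation_reflect minus_minus)
  qed (use pos in auto)
  ultimately show ?thesis by simp
qed

section \<open>Centered balls against balls of the same mass\<close>

text \<open>
Here $[u, v]$ is the part of the ball $[m - a, m + a]$ inside the support, and the ball is centered
at the best estimate for it. An interval of the same mass that starts further right
also ends further right and still meets the support, so the support does not cut $[m - a, m + a]$
at its right end. Hence $v = m + a$, and the right half of $[u, v]$ is at least as long as the left one.
\<close>
lemma abs_deviation_le_shift_right:
  fixes f :: "real \<Rightarrow> real"
  assumes f: "integrable lborel f" and lc: "log_concave_density f"
    and uv: "u < v" and pos: "\<And>x. x \<in> {u<..<v} \<Longrightarrow> 0 < f x"
    and wz: "w < z" and pos': "\<And>x. x \<in> {w<..<z} \<Longrightarrow> 0 < f x"
    and uw: "u < w" and mass: "integral {u..v} f = integral {w..z} f"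
    and radius: "m - u \<le> a" and right_end: "v = m + a \<or> (\<forall>x>v. f x = 0)"
    and min: "\<And>y. integral {u..v} (\<lambda>x. \<bar>x - m\<bar> * f x) \<le> integral {u..v} (\<lambda>x. \<bar>x - y\<bar> * f x)"
  shows "integral {u..v} (\<lambda>x. \<bar>x - m\<bar> * f x) \<le> integral {w..z} (\<lambda>x. \<bar>x - y\<bar> * f x)"
proof -
  have nonneg: "0 \<le> f x" for x
    using lc by (simp add: log_concave_density_def)
  note fint = density_integrable_on[OF f]
  note combine = Henstock_Kurzweil_Integration.integral_combine[OF _ _ fint]
  have vz: "v < z"
  proof (rule ccontr)
    assume "\<not> v < z"
    then have zv: "z \<le> v" by simp
    have "0 < integral {u..w} f"
      using integral_density_pos[OF f pos log_concave_density_concave_on_interval[OF lc pos], of u v u w]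
        uw wz zv by simp
    moreover have "0 \<le> integral {z..v} f"
      using nonneg by (intro integral_nonneg fint) auto
    moreover have "integral {u..w} f + integral {w..z} f + integral {z..v} f = integral {u..v} f"
      using combine[of u w z] combine[of u z v] uw wz zv by simp
    ultimately show False
      using mass by simp
  qed
  \<comment> \<open>There is mass beyond \<^term>\<open>v\<close>, so \<^term>\<open>v\<close> is not the end of the support.\<close>
  have "0 < f ((max v w + z) / 2)"
    using vz wz by (intro pos') (auto simp: max_def field_simps)
  moreover have "v < (max v w + z) / 2"
    using vz wz by (auto simp: max_def field_simps)
  ultimately have v: "v = m + a"
    using right_end by force
  have pos_uz: "0 < f x" if x: "x \<in> {u<..<z}" for x
  proof (rule log_concave_density_pos_between[OF lc])
    show "0 < f ((u + min x v) / 2)" "0 < f ((max x w + z) / 2)"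
      using x uv vz uw wz by (intro pos pos'; auto simp: min_def max_def field_simps)+
  qed (use x uv wz in \<open>auto simp: min_def max_def field_simps\<close>)
  obtain c where c: "u \<le> c" "c \<le> v" "integral {u..c} f = integral {c..v} f"
    using median_exists[OF f nonneg less_imp_le[OF uv]] by blast
  obtain d where d: "w \<le> d" "d \<le> z" "integral {w..d} f = integral {d..z} f"
    using median_exists[OF f nonneg less_imp_le[OF wz]] by blast
  have mc: "m = c"
    by (rule abs_deviation_minimizer_eq_median[OF f lc uv pos c min])
  have "integral {u..c} f = integral {w..d} f"
    using combine[of u c v] combine[of w d z] c d mass by simp
  then have "integral {c..v} (\<lambda>x. x * f x) - integral {u..c} (\<lambda>x. x * f x)
      \<le> integral {d..z} (\<lambda>x. x * f x) - integral {w..d} (\<lambda>x. x * f x)"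
    using radius v c d uw vz unfolding mc
    by (intro deviation_gap_le_of_shift_right[OF f pos_uz log_concave_density_concave_on_interval[OF lc pos_uz],
          where h = "integral {u..c} f"]) auto
  then show ?thesis
    using abs_deviation_ge_median(2)[OF f nonneg c] abs_deviation_ge_median(1)[OF f nonneg d, of y]
    unfolding mc by linarith
qed

text \<open>
The quantile argument needs a positive density. An interval that charges the support
can be shrunk to one inside it, and an end moves only if it lies outside the support.
\<close>
lemma trim_interval_to_support:
  fixes f :: "real \<Rightarrow> real"
  assumes lc: "log_concave_density f" and mass: "0 < integral {l..r} f"
  obtains u v where "l \<le> u" "u < v" "v \<le> r"
    "\<And>x. x \<in> {u<..<v} \<Longrightarrow> 0 < f x"
    "u = l \<or> (\<forall>x<u. f x = 0)" "v = r \<or> (\<forall>x>v. f x = 0)"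
    "\<And>g. integral {l..r} (\<lambda>x. g x * f x) = integral {u..v} (\<lambda>x. g x * f x :: real)"
proof -
  define T where "T = {x \<in> {l..r}. 0 < f x}"
  define u v where "u = Inf T" and "v = Sup T"
  have nonneg: "0 \<le> f x" for x
    using lc by (simp add: log_concave_density_def)
  have zero: "f x = 0" if "x \<in> {l..r}" "x \<notin> T" for x
    using that nonneg[of x] by (force simp: T_def)
  have two_points: "\<exists>x\<in>T. x \<noteq> p" for p
  proof (rule ccontr)
    assume "\<not> (\<exists>x\<in>T. x \<noteq> p)"
    then have "integral {l..r} f = integral {l..r} (\<lambda>x. 0)"
      by (intro integral_spike[of "{p}"]) (use zero in auto)
    then show False using mass by simp
  qed
  have bdd: "bdd_below T" "bdd_above T"
    by (auto simp: T_def)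
  have bounds: "u \<le> x" "x \<le> v" if "x \<in> T" for x
    unfolding u_def v_def using that bdd by (auto intro: cInf_lower cSup_upper)
  obtain s where s: "s \<in> T" using two_points by blast
  obtain t where t: "t \<in> T" "t \<noteq> s" using two_points by blast
  have uv: "u < v"
    using bounds[OF s] bounds[OF t(1)] t(2) by linarith
  have lu: "l \<le> u" and vr: "v \<le> r"
    unfolding u_def v_def using s by (auto simp: T_def intro!: cInf_greatest cSup_least)
  have pos: "0 < f x" if x: "x \<in> {u<..<v}" for x
  proof -
    have "T \<noteq> {}" using s by blast
    then obtain p q where "p \<in> T" "p < x" "q \<in> T" "x < q"
      using x bdd cInf_less_iff[of T x] less_cSup_iff[of T x] by (auto simp: u_def v_def)
    then show ?thesis
      using log_concave_density_pos_between[OF lc, of p q x] by (auto simp: T_def)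
  qed
  have left_end: "f x = 0" if "u \<noteq> l" "x < u" for x
  proof (rule ccontr)
    assume "f x \<noteq> 0"
    then have "0 < f x" using nonneg[of x] by simp
    then have "max x l \<in> T"
      using log_concave_density_pos_between[OF lc, of x s "max x l"] s bounds(1)[OF s] that by (auto simp: T_def)
    then show False
      using bounds(1)[of "max x l"] that lu by auto
  qed
  have right_end: "f x = 0" if "v \<noteq> r" "v < x" for x
  proof (rule ccontr)
    assume "f x \<noteq> 0"
    then have "0 < f x" using nonneg[of x] by simp
    then have "min x r \<in> T"
      using log_concave_density_pos_between[OF lc, of s x "min x r"] s bounds(2)[OF s] that by (auto simp: T_def)
    then show False
      using bounds(2)[of "min x r"] that vr by auto
  qed
  have trim: "integral {l..r} (\<lambda>x. g x * f x) = integral {u..v} (\<lambda>x. g x * f x)" for g :: "real \<Rightarrow> real"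
  proof -
    have "x \<in> {u..v}" if "x \<in> {l..r}" "f x \<noteq> 0" for x
      using zero[of x] bounds[of x] that by auto
    then have eq: "(\<lambda>x. if x \<in> {l..r} then g x * f x else 0) = (\<lambda>x. if x \<in> {u..v} then g x * f x else 0)"
      using lu vr by (force simp: fun_eq_iff)
    show ?thesis
      using eq integral_restrict_UNIV[of "{l..r}" "\<lambda>x. g x * f x"]
        integral_restrict_UNIV[of "{u..v}" "\<lambda>x. g x * f x"] by metis
  qed
  show thesis
  proof (rule that[OF lu uv vr pos])
    show "u = l \<or> (\<forall>x<u. f x = 0)" "v = r \<or> (\<forall>x>v. f x = 0)"
      using left_end right_end by blast+
  qed (use trim in auto)
qed

text \<open>
Two intervals of equal mass in the support are ordered by their left ends. If the second one lies to
the left of the first, the reflection $x \mapsto -x$ reduces to the case of a shift to the right; if the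
left ends agree, the intervals agree and only the minimality of $m$ is left.
\<close>
lemma abs_deviation_centered_ball_le:
  fixes f :: "real \<Rightarrow> real"
  assumes f: "integrable lborel f" and lc: "log_concave_density f"
    and mass_pos: "0 < integral {m - a..m + a} f"
    and mass: "integral {m - a..m + a} f = integral {y - b..y + b} f"
    and min: "\<And>y. integral {m - a..m + a} (\<lambda>x. \<bar>x - m\<bar> * f x) \<le> integral {m - a..m + a} (\<lambda>x. \<bar>x - y\<bar> * f x)"
  shows "integral {m - a..m + a} (\<lambda>x. \<bar>x - m\<bar> * f x) \<le> integral {y - b..y + b} (\<lambda>x. \<bar>x - y\<bar> * f x)"
proof -
  obtain u v where uv: "m - a \<le> u" "u < v" "v \<le> m + a"
    and pos: "\<And>x. x \<in> {u<..<v} \<Longrightarrow> 0 < f x"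
    and ends: "u = m - a \<or> (\<forall>x<u. f x = 0)" "v = m + a \<or> (\<forall>x>v. f x = 0)"
    and trim: "\<And>g. integral {m - a..m + a} (\<lambda>x. g x * f x) = integral {u..v} (\<lambda>x. g x * f x :: real)"
    by (rule trim_interval_to_support[OF lc mass_pos]) (rule that)
  obtain w z where wz: "y - b \<le> w" "w < z" "z \<le> y + b"
    and pos': "\<And>x. x \<in> {w<..<z} \<Longrightarrow> 0 < f x"
    and trim': "\<And>g. integral {y - b..y + b} (\<lambda>x. g x * f x) = integral {w..z} (\<lambda>x. g x * f x :: real)"
    by (rule trim_interval_to_support[OF lc mass_pos[unfolded mass]]) (rule that)
  have nonneg: "0 \<le> f x" for x
    using lc by (simp add: log_concave_density_def)
  note fint = density_integrable_on[OF f]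
  note combine = Henstock_Kurzweil_Integration.integral_combine[OF _ _ fint]
  have mass_eq: "integral {u..v} f = integral {w..z} f"
    using trim[of "\<lambda>_. 1"] trim'[of "\<lambda>_. 1"] mass by simp
  have min': "integral {u..v} (\<lambda>x. \<bar>x - m\<bar> * f x) \<le> integral {u..v} (\<lambda>x. \<bar>x - y\<bar> * f x)" for y
    using min by (simp add: trim)
  have less_mass: "integral {q..r} f < integral {p..s} f"
    if "p \<le> q" "q \<le> r" "r \<le> s" "p < q \<or> r < s" "\<And>x. x \<in> {p<..<s} \<Longrightarrow> 0 < f x" for p q r s
  proof -
    note posI = integral_density_pos[OF f that(5) log_concave_density_concave_on_interval[OF lc that(5)]]
    have "p < q \<Longrightarrow> 0 < integral {p..q} f" "r < s \<Longrightarrow> 0 < integral {r..s} f"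
      using posI[of p q] posI[of r s] that(1-3) by auto
    moreover have "0 \<le> integral {p..q} f" "0 \<le> integral {r..s} f"
      using nonneg by (intro integral_nonneg fint; simp)+
    moreover have "integral {p..q} f + integral {q..r} f + integral {r..s} f = integral {p..s} f"
      using combine[of p q r] combine[of p r s] that(1-3) by simp
    ultimately show ?thesis
      using that(4) by linarith
  qed
  consider "u < w" | "w < u" | "u = w" by linarith
  then have "integral {u..v} (\<lambda>x. \<bar>x - m\<bar> * f x) \<le> integral {w..z} (\<lambda>x. \<bar>x - y\<bar> * f x)"
  proof cases
    case 1
    then show ?thesis
      using abs_deviation_le_shift_right[OF f lc uv(2) pos wz(2) pos' _ mass_eq _ ends(2) min'] uv by simp
  next
    case 2
    have vz: "z < v"
      using less_mass[of w u v z] mass_eq 2 uv(2) pos' by force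
    have "integral {- v..- u} (\<lambda>x. \<bar>x - (- m)\<bar> * f (- x)) \<le> integral {- z..- w} (\<lambda>x. \<bar>x - (- y)\<bar> * f (- x))"
    proof (rule abs_deviation_le_shift_right[OF integrable_reflect[OF f] log_concave_density_reflect[OF lc]])
      show "integral {- v..- u} (\<lambda>x. f (- x)) = integral {- z..- w} (\<lambda>x. f (- x))"
        using mass_eq by simp
      show "- m - - v \<le> a" using uv by simp
      show "- u = - m + a \<or> (\<forall>x>- u. f (- x) = 0)"
        using ends(1) by auto
      show "integral {- v..- u} (\<lambda>x. \<bar>x - - m\<bar> * f (- x)) \<le> integral {- v..- u} (\<lambda>x. \<bar>x - y\<bar> * f (- x))" for y
        using min' by (simp only: abs_deviation_reflect minus_minus)
    qed (use uv wz vz pos pos' in auto)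
    then show ?thesis
      by (simp only: abs_deviation_reflect minus_minus)
  next
    case 3
    have "v = z"
      using less_mass[of u u v z] less_mass[of u u z v] mass_eq 3 uv(2) wz(2) pos pos' by (cases v z rule: linorder_cases) auto
    then show ?thesis
      using min' 3 by simp
  qed
  then show ?thesis
    by (simp only: trim trim')
qed

section \<open>Conditional distortion as a mean under the distribution\<close>

lemma cond_mean_distortion_distr:
  assumes X[measurable]: "X \<in> borel_measurable M" and \<delta>[measurable]: "\<delta> \<in> borel_measurable borel"
    and A[measurable]: "A \<in> sets borel"
  shows "cond_mean_distortion M X \<delta> A y
    = (\<integral>\<^sup>+x. ennreal (\<delta> (x - y)) * indicator A x \<partial>distr M borel X) / emeasure (distr M borel X) A"
proof -
  let ?E = "{\<omega> \<in> space M. X \<omega> \<in> A}"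
  have E: "?E \<in> sets M" by measurable
  have "cond_mean_distortion M X \<delta> A y
      = (\<integral>\<^sup>+\<omega>. ennreal (\<delta> (X \<omega> - y)) * indicator ?E \<omega> \<partial>M) / emeasure M ?E"
    unfolding cond_mean_distortion_def by (rule nn_integral_uniform_measure[OF _ E]) measurable
  also have "(\<integral>\<^sup>+\<omega>. ennreal (\<delta> (X \<omega> - y)) * indicator ?E \<omega> \<partial>M)
      = (\<integral>\<^sup>+\<omega>. ennreal (\<delta> (X \<omega> - y)) * indicator A (X \<omega>) \<partial>M)"
    by (intro nn_integral_cong) (auto simp: indicator_def)
  also have "\<dots> = (\<integral>\<^sup>+x. ennreal (\<delta> (x - y)) * indicator A x \<partial>distr M borel X)"
    by (subst nn_integral_distr) auto
  also have "emeasure M ?E = emeasure (distr M borel X) A"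
    by (subst emeasure_distr) (auto simp: vimage_def Int_def conj_commute)
  finally show ?thesis .
qed

text \<open>
The two functions of the estimate are equal, so the arbitrary choice of a minimizer is the same for both
sets, even if there are several minimizers or none.
\<close>
lemma cond_mean_distortion_cong_AE:
  assumes X: "X \<in> borel_measurable M" and \<delta>: "\<delta> \<in> borel_measurable borel"
    and A: "A \<in> sets borel" and B: "B \<in> sets borel"
    and AE: "AE x in distr M borel X. x \<in> A \<longleftrightarrow> x \<in> B"
  shows "cond_mean_distortion M X \<delta> A = cond_mean_distortion M X \<delta> B"
proof
  fix y
  have "(\<integral>\<^sup>+x. ennreal (\<delta> (x - y)) * indicator A x \<partial>distr M borel X)
      = (\<integral>\<^sup>+x. ennreal (\<delta> (x - y)) * indicator B x \<partial>distr M borel X)"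
    by (rule nn_integral_cong_AE) (use AE in \<open>auto elim!: eventually_mono simp: indicator_def\<close>)
  moreover have "emeasure (distr M borel X) A = emeasure (distr M borel X) B"
    by (rule emeasure_eq_AE[OF AE]) (use A B in auto)
  ultimately show "cond_mean_distortion M X \<delta> A y = cond_mean_distortion M X \<delta> B y"
    by (simp add: cond_mean_distortion_distr[OF X \<delta> A] cond_mean_distortion_distr[OF X \<delta> B])
qed

section \<open>Sublevel sets minimize the conditional mean\<close>

text \<open>
Outside $A \cap B$, the part of $A$ carries values at least $\kappa$ and the part of $B$ values at most
$\kappa$, and $A$ has at least as much mass there. The mean of $g$ over $A \cap B$ is at most $\kappa$, so
more mass at levels at least $\kappa$ can only raise it. The integral over $A$ may be infinite;
the part over $A - B$ enters only through a finite lower bound.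
\<close>
lemma mean_over_sublevel_set_le:
  fixes g :: "'a \<Rightarrow> real" and \<kappa> :: real
  assumes N: "finite_measure N" and g[measurable]: "g \<in> borel_measurable N"
    and A[measurable]: "A \<in> sets N" and B[measurable]: "B \<in> sets N"
    and \<kappa>: "0 \<le> \<kappa>" and inside: "\<And>x. x \<in> B \<Longrightarrow> g x \<le> \<kappa>" and outside: "\<And>x. x \<in> A \<Longrightarrow> x \<notin> B \<Longrightarrow> \<kappa> \<le> g x"
    and pos: "0 < measure N B" and le: "measure N B \<le> measure N A"
  shows "(\<integral>\<^sup>+x. ennreal (g x) * indicator B x \<partial>N) / emeasure N B
       \<le> (\<integral>\<^sup>+x. ennreal (g x) * indicator A x \<partial>N) / emeasure N A"
proof -
  interpret finite_measure N by fact
  define J where "J C = (\<integral>\<^sup>+x. ennreal (g x) * indicator C x \<partial>N)" for C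
  define \<alpha> \<beta> \<gamma> where "\<alpha> = measure N (A \<inter> B)" and "\<beta> = measure N (A - B)" and "\<gamma> = measure N (B - A)"
  have J_split: "J C = J (C \<inter> D) + J (C - D)" if [measurable]: "C \<in> sets N" "D \<in> sets N" for C D
    unfolding J_def by (subst nn_integral_add[symmetric]) (auto intro!: nn_integral_cong simp: indicator_def)
  have J_le: "J C \<le> ennreal (\<kappa> * measure N C)" if [measurable]: "C \<in> sets N" and "C \<subseteq> B" for C
  proof -
    have "J C \<le> (\<integral>\<^sup>+x. ennreal \<kappa> * indicator C x \<partial>N)"
      unfolding J_def using inside that(2)
      by (intro nn_integral_mono) (auto simp: indicator_def intro: ennreal_leI)
    also have "\<dots> = ennreal (\<kappa> * measure N C)"
      using \<kappa> by (simp add: nn_integral_cmult_indicator emeasure_eq_measure ennreal_mult)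
    finally show ?thesis .
  qed
  have J_ge: "ennreal (\<kappa> * \<beta>) \<le> J (A - B)"
  proof -
    have "ennreal (\<kappa> * \<beta>) = (\<integral>\<^sup>+x. ennreal \<kappa> * indicator (A - B) x \<partial>N)"
      using \<kappa> by (simp add: nn_integral_cmult_indicator emeasure_eq_measure ennreal_mult \<beta>_def)
    also have "\<dots> \<le> J (A - B)"
      unfolding J_def using outside
      by (intro nn_integral_mono) (auto simp: indicator_def intro: ennreal_leI)
    finally show ?thesis .
  qed
  have mA: "measure N A = \<alpha> + \<beta>" and mB: "measure N B = \<alpha> + \<gamma>"
    using finite_measure_Diff'[OF A B] finite_measure_Diff'[OF B A]
    by (simp_all add: \<alpha>_def \<beta>_def \<gamma>_def Int_commute)
  have nn: "0 \<le> \<alpha>" "0 \<le> \<beta>" "0 \<le> \<gamma>"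
    by (simp_all add: \<alpha>_def \<beta>_def \<gamma>_def)
  have J_int: "J (A \<inter> B) \<le> ennreal (\<kappa> * \<alpha>)"
    unfolding \<alpha>_def by (rule J_le) auto
  then obtain i where i: "J (A \<inter> B) = ennreal i" "0 \<le> i"
    by (cases "J (A \<inter> B)") (auto simp: top_unique)
  then have i_le: "i \<le> \<kappa> * \<alpha>"
    using J_int \<kappa> nn by (simp add: ennreal_le_iff)
  \<comment> \<open>This product is the numerator of the difference of the two means below.\<close>
  have "0 \<le> (\<beta> - \<gamma>) * (\<kappa> * \<alpha> - i)"
    using le mA mB i_le by simp
  then have cross: "(i + \<kappa> * \<gamma>) / (\<alpha> + \<gamma>) \<le> (i + \<kappa> * \<beta>) / (\<alpha> + \<beta>)"
    using pos le mA mB by (simp add: divide_simps) (simp add: algebra_simps)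
  have "J B / emeasure N B \<le> ennreal (i + \<kappa> * \<gamma>) / ennreal (\<alpha> + \<gamma>)"
  proof -
    have "J B = ennreal i + J (B - A)"
      using J_split[OF B A] i(1) by (simp add: Int_commute)
    also have "\<dots> \<le> ennreal (i + \<kappa> * \<gamma>)"
      using J_le[of "B - A"] i(2) \<kappa> nn by (simp add: \<gamma>_def ennreal_plus add_left_mono)
    finally show ?thesis
      by (simp add: emeasure_eq_measure mB divide_right_mono_ennreal)
  qed
  also have "\<dots> \<le> ennreal (i + \<kappa> * \<beta>) / ennreal (\<alpha> + \<beta>)"
    using cross pos le mA mB i(2) \<kappa> nn by (simp add: divide_ennreal ennreal_leI del: ennreal_plus)
  also have "\<dots> \<le> J A / emeasure N A"
  proof -
    have "ennreal (i + \<kappa> * \<beta>) \<le> J A"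
      using J_split[OF A B] i J_ge \<kappa> nn by (simp add: ennreal_plus add_left_mono)
    then show ?thesis
      by (simp add: emeasure_eq_measure mA divide_right_mono_ennreal)
  qed
  finally show ?thesis
    by (simp add: J_def)
qed

lemma nn_integral_density_interval:
  fixes f g :: "real \<Rightarrow> real"
  assumes f: "integrable lborel f" and nonneg: "\<And>x. 0 \<le> f x"
    and g: "continuous_on UNIV g" "\<And>x. 0 \<le> g x"
  shows "(\<integral>\<^sup>+x. ennreal (g x) * indicator {a..b} x \<partial>density lborel (\<lambda>x. ennreal (f x)))
    = ennreal (integral {a..b} (\<lambda>x. g x * f x))"
proof -
  have [measurable]: "f \<in> borel_measurable borel" "g \<in> borel_measurable borel"
    using f g(1) by (auto intro: borel_measurable_continuous_onI)
  have int: "set_integrable lborel {a..b} (\<lambda>x. g x * f x)"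
    by (rule set_integrable_continuous_mult[OF f continuous_on_subset[OF g(1)]]) simp
  have "(\<integral>\<^sup>+x. ennreal (g x) * indicator {a..b} x \<partial>density lborel (\<lambda>x. ennreal (f x)))
      = (\<integral>\<^sup>+x. ennreal (indicator {a..b} x *\<^sub>R (g x * f x)) \<partial>lborel)"
    using nonneg g(2)
    by (subst nn_integral_density) (auto intro!: nn_integral_cong simp: indicator_def ennreal_mult mult.commute)
  also have "\<dots> = ennreal (LINT x : {a..b} | lborel. g x * f x)"
    unfolding set_lebesgue_integral_def
    by (rule nn_integral_eq_integral) (use int nonneg g(2) in \<open>auto simp: set_integrable_def\<close>)
  finally show ?thesis
    by (simp add: set_borel_integral_eq_integral(2)[OF int])
qed

lemma emeasure_density_interval:
  fixes f :: "real \<Rightarrow> real"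
  assumes f: "integrable lborel f" and nonneg: "\<And>x. 0 \<le> f x"
  shows "emeasure (density lborel (\<lambda>x. ennreal (f x))) {a..b} = ennreal (integral {a..b} f)"
  using nn_integral_density_interval[OF assms, of "\<lambda>_. 1" a b] by simp

section \<open>Centered sets are balls\<close>

text \<open>
The mass of the ball is continuous in the radius, is $0$ at radius $0$ and tends to $1$.
For $\eta = 1$ no finite radius need exist.
\<close>
lemma ball_of_given_mass:
  fixes f :: "real \<Rightarrow> real"
  assumes f: "integrable lborel f" and nonneg: "\<And>x. 0 \<le> f x"
    and prob: "prob_space (density lborel (\<lambda>x. ennreal (f x)))" and \<eta>: "0 \<le> \<eta>" "\<eta> < 1"
  obtains b where "0 \<le> b" "integral {y - b..y + b} f = \<eta>"
proof -
  interpret prob_space "density lborel (\<lambda>x. ennreal (f x))" by fact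
  note fint = density_integrable_on[OF f]
  have mass: "prob {a..b} = integral {a..b} f" for a b
    using emeasure_density_interval[OF f nonneg, of a b] integral_nonneg[OF fint[of a b]] nonneg
    by (simp add: measure_def)
  have "(\<lambda>n. prob {y - real n..y + real n}) \<longlonglongrightarrow> prob (\<Union>n. {y - real n..y + real n})"
    by (rule finite_Lim_measure_incseq) (auto simp: incseq_def)
  moreover have "(\<Union>n. {y - real n..y + real n}) = UNIV"
  proof -
    have "\<exists>n. x \<in> {y - real n..y + real n}" for x
      using real_arch_simple[of "\<bar>x - y\<bar>"] by (auto simp: abs_le_iff algebra_simps)
    then show ?thesis by blast
  qed
  ultimately have "(\<lambda>n. prob {y - real n..y + real n}) \<longlonglongrightarrow> 1"
    using prob_space by simp
  then obtain n where n: "\<eta> < prob {y - real n..y + real n}"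
    using order_tendstoD(1)[OF _ \<eta>(2)] eventually_happens'[OF sequentially_bot] by blast
  define G where "G x = integral {y - real n..x} f" for x
  have contG: "continuous_on {y - real n..y + real n} G"
    unfolding G_def by (rule indefinite_integral_continuous_1[OF fint])
  have diff: "integral {y - b..y + b} f = G (y + b) - G (y - b)" if "0 \<le> b" "b \<le> real n" for b
    using Henstock_Kurzweil_Integration.integral_combine[of "y - real n" "y - b" "y + b" f, OF _ _ fint] that
    by (simp add: G_def)
  have "\<exists>b\<ge>0. b \<le> real n \<and> G (y + b) - G (y - b) = \<eta>"
  proof (rule IVT')
    show "G (y + 0) - G (y - 0) \<le> \<eta>" "\<eta> \<le> G (y + real n) - G (y - real n)"
      using \<eta> n diff[of "real n"] mass by auto
    show "continuous_on {0..real n} (\<lambda>b. G (y + b) - G (y - b))"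
      by (intro continuous_intros continuous_on_compose2[OF contG]) auto
  qed simp
  then show thesis
    using that diff by metis
qed

text \<open>
A ball of mass $\eta$ around the estimate contains the centering, whose radius is the infimum of all
radii that reach this mass. So $S$ lies in the ball up to a null set, and since its mass is at least that
of the ball, the reverse inclusion holds up to a null set as well.
\<close>
lemma centered_eq_ball_AE:
  assumes M: "prob_space M" and X[measurable]: "X \<in> borel_measurable M"
    and adm: "admissible_silence_set M X \<eta> S" and cen: "centered M X (\<lambda>x. \<bar>x\<bar>) \<eta> S"
    and m: "m = best_estimate M X (\<lambda>x. \<bar>x\<bar>) S"
    and a: "0 \<le> a" "measure (distr M borel X) {m - a..m + a} = \<eta>"
  shows "AE x in distr M borel X. x \<in> S \<longleftrightarrow> x \<in> {m - a..m + a}"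
proof -
  interpret prob_space M by fact
  let ?N = "distr M borel X"
  interpret N: prob_space ?N by (rule prob_space_distr[OF X])
  have P: "\<P>(\<omega> in M. X \<omega> \<in> C) = measure ?N C" if "C \<in> sets borel" for C
    using that by (subst measure_distr) (auto simp: vimage_def Int_def conj_commute)
  have S[measurable]: "S \<in> sets borel" and S_mass: "\<eta> \<le> measure ?N S"
    using adm P[of S] by (auto simp: admissible_silence_set_def)
  have "{\<omega> \<in> space M. \<bar>X \<omega> - m\<bar> \<le> a} = {\<omega> \<in> space M. X \<omega> \<in> {m - a..m + a}}"
    by (auto simp: abs_le_iff)
  then have "centering_radius M X (\<lambda>x. \<bar>x\<bar>) \<eta> S \<le> ereal a"
    unfolding centering_radius_def m[symmetric] using a P[of "{m - a..m + a}"]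
    by (intro Inf_lower imageI) simp
  then have sub: "centering M X (\<lambda>x. \<bar>x\<bar>) \<eta> S \<subseteq> {m - a..m + a}"
    unfolding centering_def m[symmetric] using order_trans by (force simp: abs_le_iff)
  have cen_meas[measurable]: "centering M X (\<lambda>x. \<bar>x\<bar>) \<eta> S \<in> sets borel"
    unfolding centering_def by measurable
  have "measure ?N (S - centering M X (\<lambda>x. \<bar>x\<bar>) \<eta> S) = 0"
    using cen P[of "S - centering M X (\<lambda>x. \<bar>x\<bar>) \<eta> S"] S cen_meas by (simp add: centered_def)
  then have S_null: "measure ?N (S - {m - a..m + a}) = 0"
    using N.finite_measure_mono[of "S - {m - a..m + a}" "S - centering M X (\<lambda>x. \<bar>x\<bar>) \<eta> S"] sub
    by (auto simp: measure_le_0_iff)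
  have "measure ?N (S - {m - a..m + a}) = measure ?N S - measure ?N (S \<inter> {m - a..m + a})"
    "measure ?N ({m - a..m + a} - S) = measure ?N {m - a..m + a} - measure ?N (S \<inter> {m - a..m + a})"
    using N.finite_measure_Diff'[of S "{m - a..m + a}"] N.finite_measure_Diff'[of "{m - a..m + a}" S]
    by (simp_all add: Int_commute)
  then have "measure ?N ({m - a..m + a} - S) = 0"
    using S_mass a(2) S_null measure_nonneg[of ?N "{m - a..m + a} - S"] by linarith
  then have "AE x in ?N. x \<notin> {m - a..m + a} - S" "AE x in ?N. x \<notin> S - {m - a..m + a}"
    using S_null by (auto intro!: AE_not_in simp: null_sets_def N.emeasure_eq_measure simp del: Diff_iff)
  then show ?thesis
    by eventually_elim auto
qed

section \<open>Optimality of centered silence sets\<close>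

theorem corollary2p1:
  fixes M :: "'a measure" and X :: "'a \<Rightarrow> real" and f :: "real \<Rightarrow> real"
    and \<eta> :: real and S :: "real set"
  assumes "prob_space M"
    and "distributed M lborel X (\<lambda>x. ennreal (f x))"
    and "log_concave_density f"
    and "0 \<le> \<eta>" and "\<eta> \<le> 1"
    and "admissible_silence_set M X \<eta> S"
    and "centered M X (\<lambda>x. \<bar>x\<bar>) \<eta> S"
  shows "is_arg_min (estimation_error M X (\<lambda>x. \<bar>x\<bar>)) (admissible_silence_set M X \<eta>) S"
proof -
  interpret prob_space M by fact
  let ?\<delta> = "\<lambda>x::real. \<bar>x\<bar>"
  define N where "N = distr M borel X"
  have X[measurable]: "X \<in> borel_measurable M"
    using distributed_measurable[OF assms(2)] by simp
  interpret N: prob_space N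
    unfolding N_def by (rule prob_space_distr[OF X])
  have setsN[simp]: "sets N = sets borel"
    by (simp add: N_def)
  have spaceN[simp]: "space N = UNIV"
    by (simp add: N_def)
  have nonneg: "0 \<le> f x" for x
    using assms(3) by (simp add: log_concave_density_def)
  have N_density: "N = density lborel (\<lambda>x. ennreal (f x))"
    using distributed_distr_eq_density[OF assms(2)] by (simp add: N_def cong: distr_cong)
  have "(\<lambda>x. ennreal (f x)) \<in> borel_measurable lborel"
    by (rule distributed_borel_measurable[OF assms(2)])
  then have f_meas[measurable]: "f \<in> borel_measurable borel"
    using nonneg by (subst measurable_cong[of _ f "\<lambda>x. enn2real (ennreal (f x))"]) auto
  have "(\<integral>\<^sup>+x. ennreal (f x) \<partial>lborel) = 1"
    using N.emeasure_space_1 by (simp add: N_density emeasure_density)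
  then have f: "integrable lborel f"
    using nonneg by (intro integrableI_nonneg) auto
  have P: "\<P>(\<omega> in M. X \<omega> \<in> C) = measure N C" if "C \<in> sets borel" for C
    unfolding N_def using that by (subst measure_distr) (auto simp: vimage_def Int_def conj_commute)
  have adm: "admissible_silence_set M X \<eta> A \<longleftrightarrow> A \<in> sets borel \<and> \<eta> \<le> measure N A" for A
    using P by (auto simp: admissible_silence_set_def)
  have S[measurable]: "S \<in> sets borel"
    using assms(6) adm by simp
  have err: "cond_mean_distortion M X ?\<delta> A y = (\<integral>\<^sup>+x. ennreal \<bar>x - y\<bar> * indicator A x \<partial>N) / emeasure N A"
    if "A \<in> sets borel" for A y
    unfolding N_def using cond_mean_distortion_distr[OF X _ that, of ?\<delta>] by simp
  have err_cong: "cond_mean_distortion M X ?\<delta> A = cond_mean_distortion M X ?\<delta> B"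
    if "A \<in> sets borel" "B \<in> sets borel" "AE x in N. x \<in> A \<longleftrightarrow> x \<in> B" for A B
    using cond_mean_distortion_cong_AE[OF X _ that[unfolded N_def], of ?\<delta>] by simp
  have interval_err: "cond_mean_distortion M X ?\<delta> {a..b} y
      = ennreal (integral {a..b} (\<lambda>x. \<bar>x - y\<bar> * f x)) / ennreal (integral {a..b} f)" for a b y
    unfolding err[OF atLeastAtMost_borel] unfolding N_density
    by (simp only: emeasure_density_interval[OF f nonneg])
      (subst nn_integral_density_interval[OF f nonneg], auto intro!: continuous_intros)
  have interval_mass: "measure N {a..b} = integral {a..b} f" for a b
    using emeasure_density_interval[OF f nonneg, of a b] integral_nonneg[OF density_integrable_on[OF f]] nonneg
    by (simp add: measure_def N_density)
  have "estimation_error M X ?\<delta> S \<le> estimation_error M X ?\<delta> A" if A_adm: "admissible_silence_set M X \<eta> A" for A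
  proof -
    have A[measurable]: "A \<in> sets borel" and A_mass: "\<eta> \<le> measure N A"
      using A_adm adm by auto
    show ?thesis
    proof (cases "\<eta> = 1")
      case True
      \<comment> \<open>All admissible sets have full measure and hence the same error. The centering can be unbounded
        here, so the ball argument does not apply.\<close>
      have "AE x in N. x \<in> C" if "admissible_silence_set M X \<eta> C" for C
        using that True adm by (intro N.AE_prob_1 antisym N.prob_le_1) auto
      then have "AE x in N. x \<in> S \<longleftrightarrow> x \<in> A"
        using assms(6) A_adm by (auto intro: eventually_elim2)
      then show ?thesis
        using err_cong[OF S A] by (simp add: estimation_error_def best_estimate_def)
    next
      case False
      then have \<eta>_less: "\<eta> < 1" using assms(5) by simp
      have ball: "\<exists>b\<ge>0. integral {y - b..y + b} f = \<eta>" for y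
        using ball_of_given_mass[OF f nonneg N.prob_space_axioms[unfolded N_density] assms(4) \<eta>_less] by metis
      define m where "m = best_estimate M X ?\<delta> S"
      obtain a where a: "0 \<le> a" "integral {m - a..m + a} f = \<eta>"
        using ball by blast
      let ?B = "{m - a..m + a}"
      have "AE x in N. x \<in> S \<longleftrightarrow> x \<in> ?B"
        unfolding N_def
        by (rule centered_eq_ball_AE[OF assms(1) X assms(6,7) m_def a(1)])
          (use a interval_mass in \<open>simp add: N_def\<close>)
      then have S_ball: "cond_mean_distortion M X ?\<delta> S = cond_mean_distortion M X ?\<delta> ?B"
        by (intro err_cong) auto
      have S_err: "estimation_error M X ?\<delta> S = cond_mean_distortion M X ?\<delta> ?B m"
        by (simp add: estimation_error_def m_def S_ball)
      show ?thesis
      proof (cases "\<eta> = 0")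
        case True
        \<comment> \<open>The set \<^term>\<open>S\<close> is null, and conditioning on a null event gives the value $0$.\<close>
        then have "emeasure N ?B = 0"
          using a interval_mass by (simp add: N.emeasure_eq_measure)
        then have "(\<integral>\<^sup>+x. ennreal \<bar>x - m\<bar> * indicator ?B x \<partial>N) = 0"
          by (intro nn_integral_null_set) (simp add: null_sets_def)
        then have "estimation_error M X ?\<delta> S = 0"
          unfolding S_err by (simp add: err)
        then show ?thesis by simp
      next
        case False
        then have \<eta>_pos: "0 < \<eta>" using assms(4) by simp
        have dev_nonneg: "0 \<le> integral {l..r} (\<lambda>x. \<bar>x - y\<bar> * f x)" for l r y
          using nonneg by (intro integral_nonneg abs_deviation_integrable_on[OF f]) simp
        have compare: "cond_mean_distortion M X ?\<delta> {l..r} y \<le> cond_mean_distortion M X ?\<delta> {l'..r'} y'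
            \<longleftrightarrow> integral {l..r} (\<lambda>x. \<bar>x - y\<bar> * f x) \<le> integral {l'..r'} (\<lambda>x. \<bar>x - y'\<bar> * f x)"
          if "integral {l..r} f = \<eta>" "integral {l'..r'} f = \<eta>" for l r y l' r' y'
          using that \<eta>_pos dev_nonneg by (simp add: interval_err divide_ennreal ennreal_le_iff divide_le_cancel)
        \<comment> \<open>A median is a minimizer, so \<^term>\<open>m\<close>, chosen among the minimizers if there are any, is one.\<close>
        obtain c where c: "m - a \<le> c" "c \<le> m + a" "integral {m - a..c} f = integral {c..m + a} f"
          using median_exists[OF f nonneg, of "m - a" "m + a"] a(1) by auto
        have "cond_mean_distortion M X ?\<delta> ?B c \<le> cond_mean_distortion M X ?\<delta> ?B y" for y
          using abs_deviation_ge_median[OF f nonneg c] compare[OF a(2) a(2)] by simp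
        then have "is_arg_min (cond_mean_distortion M X ?\<delta> S) (\<lambda>_. True) c"
          by (simp add: is_arg_min_def S_ball not_less)
        then have "is_arg_min (cond_mean_distortion M X ?\<delta> S) (\<lambda>_. True) m"
          unfolding m_def best_estimate_def arg_min_def by (rule someI)
        then have min: "integral ?B (\<lambda>x. \<bar>x - m\<bar> * f x) \<le> integral ?B (\<lambda>x. \<bar>x - y\<bar> * f x)" for y
          using compare[OF a(2) a(2)] by (simp add: is_arg_min_def S_ball not_less)
        define y where "y = best_estimate M X ?\<delta> A"
        obtain b where b: "0 \<le> b" "integral {y - b..y + b} f = \<eta>"
          using ball by blast
        \<comment> \<open>Both balls have mass \<^term>\<open>\<eta>\<close>, so the conditional means compare like the integrals.\<close>
        have "estimation_error M X ?\<delta> S \<le> cond_mean_distortion M X ?\<delta> {y - b..y + b} y"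
          unfolding S_err compare[OF a(2) b(2)]
          by (rule abs_deviation_centered_ball_le[OF f assms(3) _ _ min]) (use a b \<eta>_pos in auto)
        \<comment> \<open>The ball is a sublevel set of the distance to \<^term>\<open>y\<close>, whatever set \<^term>\<open>y\<close> came from.\<close>
        also have "\<dots> \<le> cond_mean_distortion M X ?\<delta> A y"
          unfolding err[OF A] err[OF atLeastAtMost_borel]
          by (rule mean_over_sublevel_set_le[where \<kappa> = b])
            (use b \<eta>_pos A_mass interval_mass N.finite_measure_axioms in \<open>auto simp: measurable_cong_sets[OF setsN refl]\<close>)
        finally show ?thesis
          by (simp add: estimation_error_def y_def)
      qed
    qed
  qed
  then show ?thesis
    using assms(6) by (auto simp: is_arg_min_def not_less)
qed

end
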